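(* Let $D$ be a $t$-treed integral domain. Then every valuation element of $D$ is homogeneous.
   Context: Let $D$ be an integral domain with quotient field $K$. For a nonzero fractional ideal $A$ let $A^{-1}=\{x\in K\mid xA\subseteq D\}$, $A_v=(A^{-1})^{-1}$ and $A_t=\bigcup\{I_v\mid I\subseteq A,\ I$ a nonzero finitely generated fractional ideal$\}$. $A$ is a $t$-ideal if $A_t=A$. A maximal $t$-ideal is a $t$-ideal maximal among proper integral $t$-ideals; a prime $t$-ideal is a (nonzero) prime ideal that is a $t$-ideal. $D$ is $t$-treed if the set of prime $t$-ideals of $D$ is treed under inclusion (any two prime $t$-ideals contained in a common prime $t$-ideal are comparable). An overring of $D$ is a subring of $K$ containing $D$. A nonzero nonunit $a\in D$ is a valuation element of $D$ if there is a valuation domain $V$ that is an overring of $D$ with $aV\cap D=aD$. A nonzero nonunit $x\in D$ is homogeneous if it is contained in a unique maximal $t$-ideal of $D$. *)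

theory Defs
  imports "HOL-Computational_Algebra.Polynomial_Factorial"
begin

text \<open>
  The integral domain \<open>D\<close> is a type \<open>'a :: idom\<close>, its quotient field \<open>K\<close> is the type \<open>'a fract\<close>,
  and \<open>D\<close> is identified with its image \<open>base_dom\<close> in \<open>K\<close>. All ideals, fractional ideals and
  overrings of \<open>D\<close> are subsets of \<open>K\<close>.
\<close>

abbreviation base_dom :: "'a::idom fract set" where
  "base_dom \<equiv> range to_fract"

text \<open>
  \<open>D\<close>-submodules of \<open>K\<close> are \<open>fract_mod.subspace\<close>; the submodule generated by a set is
  \<open>fract_mod.span\<close>.
\<close>

global_interpretation fract_mod: module "\<lambda>(d::'a::idom) (x::'a fract). to_fract d * x"
  by unfold_locales (simp_all add: algebra_simps)

definition nz_fractional_ideal :: "'a::idom fract set \<Rightarrow> bool" where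
  "nz_fractional_ideal A \<longleftrightarrow> fract_mod.subspace A \<and> A \<noteq> {0} \<and>
     (\<exists>d::'a. d \<noteq> 0 \<and> (\<forall>x\<in>A. to_fract d * x \<in> base_dom))"

definition nz_fg_fractional_ideal :: "'a::idom fract set \<Rightarrow> bool" where
  "nz_fg_fractional_ideal A \<longleftrightarrow> nz_fractional_ideal A \<and> (\<exists>F. finite F \<and> A = fract_mod.span F)"

definition ideal_inv :: "'a::idom fract set \<Rightarrow> 'a fract set" where
  "ideal_inv A = {x. \<forall>y\<in>A. x * y \<in> base_dom}"

definition v_closure :: "'a::idom fract set \<Rightarrow> 'a fract set" where
  "v_closure A = ideal_inv (ideal_inv A)"

definition t_closure :: "'a::idom fract set \<Rightarrow> 'a fract set" where
  "t_closure A = (\<Union>I\<in>{I. nz_fg_fractional_ideal I \<and> I \<subseteq> A}. v_closure I)"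

definition t_ideal :: "'a::idom fract set \<Rightarrow> bool" where
  "t_ideal A \<longleftrightarrow> nz_fractional_ideal A \<and> t_closure A = A"

definition maximal_t_ideal :: "'a::idom fract set \<Rightarrow> bool" where
  "maximal_t_ideal M \<longleftrightarrow> t_ideal M \<and> M \<subset> base_dom \<and>
     (\<forall>N. t_ideal N \<and> N \<subset> base_dom \<and> M \<subseteq> N \<longrightarrow> N = M)"

definition prime_ideal :: "'a::idom fract set \<Rightarrow> bool" where
  "prime_ideal P \<longleftrightarrow> fract_mod.subspace P \<and> P \<subset> base_dom \<and>
     (\<forall>x\<in>base_dom. \<forall>y\<in>base_dom. x * y \<in> P \<longrightarrow> x \<in> P \<or> y \<in> P)"

definition prime_t_ideal :: "'a::idom fract set \<Rightarrow> bool" where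
  "prime_t_ideal P \<longleftrightarrow> prime_ideal P \<and> t_ideal P"

definition t_treed :: "'a::idom itself \<Rightarrow> bool" where
  "t_treed (_ :: 'a itself) \<longleftrightarrow>
     (\<forall>P Q M :: 'a fract set. prime_t_ideal P \<and> prime_t_ideal Q \<and> prime_t_ideal M \<and>
        P \<subseteq> M \<and> Q \<subseteq> M \<longrightarrow> P \<subseteq> Q \<or> Q \<subseteq> P)"

definition overring :: "'a::idom fract set \<Rightarrow> bool" where
  "overring R \<longleftrightarrow> base_dom \<subseteq> R \<and> (\<forall>x\<in>R. \<forall>y\<in>R. x - y \<in> R \<and> x * y \<in> R)"

text \<open>
  The quotient field of an overring of \<open>D\<close> is \<open>K\<close> itself, so such a ring is a valuation domain
  iff it contains \<open>x\<close> or \<open>inverse x\<close> for every nonzero \<open>x\<close> in \<open>K\<close>. The field \<open>K\<close> counts as a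
  (trivial) valuation domain.
\<close>

definition valuation_overring :: "'a::idom fract set \<Rightarrow> bool" where
  "valuation_overring V \<longleftrightarrow> overring V \<and> (\<forall>x. x \<noteq> 0 \<longrightarrow> x \<in> V \<or> inverse x \<in> V)"

definition valuation_element :: "'a::idom \<Rightarrow> bool" where
  "valuation_element a \<longleftrightarrow> a \<noteq> 0 \<and> \<not> a dvd 1 \<and>
     (\<exists>V. valuation_overring V \<and>
        (\<lambda>v. to_fract a * v) ` V \<inter> base_dom = (\<lambda>x. to_fract a * x) ` base_dom)"

definition homogeneous :: "'a::idom \<Rightarrow> bool" where
  "homogeneous a \<longleftrightarrow> a \<noteq> 0 \<and> \<not> a dvd 1 \<and> (\<exists>!M. maximal_t_ideal M \<and> to_fract a \<in> M)"

end

theory Submission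
  imports Defs
begin

text \<open>
  Let \<open>V\<close> be a valuation overring with \<open>aV \<inter> D = aD\<close>. An easy induction gives
  \<open>a\<^sup>nV \<inter> D = a\<^sup>nD\<close> for all \<open>n\<close>. Suppose that \<open>a\<close> lies in two distinct maximal \<open>t\<close>-ideals
  \<open>M\<close> and \<open>M'\<close>; both are prime. The proof has three ingredients.

  First, a Krull-type existence theorem (\<open>prime_t_ideal_avoiding\<close>): a \<open>t\<close>-ideal disjoint
  from a multiplicative set \<open>S\<close> extends to a \<open>t\<close>-ideal maximal with this property, and every
  such maximal one is prime. All prime \<open>t\<close>-ideals of the proof arise from it, by a suitable
  choice of \<open>S\<close>.

  Second, some prime \<open>t\<close>-ideal \<open>P \<subseteq> M \<inter> M'\<close> contains \<open>a\<close>. One avoids the products \<open>st\<close>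
  with \<open>s \<notin> M\<close> and \<open>t \<notin> M'\<close>: if \<open>a\<close> divided \<open>st\<close>, where say \<open>s\<close> divides \<open>t\<close> in \<open>V\<close>, then
  \<open>t\<^sup>2 \<in> aV \<inter> D = aD \<subseteq> M'\<close>, which is absurd.

  Third, the tree condition (\<open>divides_power_locally\<close>): if \<open>x \<in> M - P\<close>, then \<open>x\<close> divides
  \<open>a\<^sup>nt\<close> for some \<open>n\<close> and some \<open>t \<in> D - M\<close>. Otherwise there would be a prime \<open>t\<close>-ideal
  \<open>Q \<subseteq> M\<close> with \<open>x \<in> Q\<close> and \<open>a \<notin> Q\<close>, and \<open>Q\<close> could not be comparable to \<open>P\<close>.

  Now take \<open>x \<in> M - M'\<close> and \<open>y \<in> M' - M\<close>, named such that \<open>y/x \<in> V\<close>. With \<open>n\<close> and \<open>t\<close> as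
  above, \<open>a\<^sup>nty/x\<close> lies in \<open>a\<^sup>nV \<inter> D = a\<^sup>nD\<close>. Hence \<open>ty \<in> xD \<subseteq> M\<close>, although neither \<open>t\<close> nor
  \<open>y\<close> belongs to the prime ideal \<open>M\<close>.
\<close>

section \<open>The base domain and divisorial closures of finite sets\<close>

lemma base_dom_0 [simp]: "0 \<in> base_dom"
  by (metis rangeI to_fract_0)

lemma base_dom_1 [simp]: "1 \<in> base_dom"
  by (metis rangeI to_fract_1)

lemma base_dom_add: "x \<in> base_dom \<Longrightarrow> y \<in> base_dom \<Longrightarrow> x + y \<in> base_dom"
  by (auto simp flip: to_fract_add)

lemma base_dom_mult: "x \<in> base_dom \<Longrightarrow> y \<in> base_dom \<Longrightarrow> x * y \<in> base_dom"
  by (auto simp flip: to_fract_mult)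

lemma subspace_mult:
  assumes "fract_mod.subspace A" "d \<in> base_dom" "x \<in> A"
  shows "d * x \<in> A"
  using assms fract_mod.subspace_scale by fastforce

lemma integral_ideal_proper_iff:
  fixes N :: "'a::idom fract set"
  assumes "fract_mod.subspace N" "N \<subseteq> base_dom"
  shows "N \<subset> base_dom \<longleftrightarrow> 1 \<notin> N"
proof
  show "1 \<notin> N" if "N \<subset> base_dom"
  proof
    assume "1 \<in> N"
    then have "base_dom \<subseteq> N"
      using subspace_mult[OF assms(1) _ \<open>1 \<in> N\<close>] by (metis mult.right_neutral subsetI)
    then show False using that by blast
  qed
  show "N \<subset> base_dom" if "1 \<notin> N"
    using that assms(2) base_dom_1 by blast
qed

lemma subspace_ideal_inv: "fract_mod.subspace (ideal_inv A)"
  unfolding fract_mod.subspace_def ideal_inv_def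
  by (auto simp: distrib_right mult.assoc intro: base_dom_add base_dom_mult)

lemma subspace_v_closure: "fract_mod.subspace (v_closure A)"
  unfolding v_closure_def by (rule subspace_ideal_inv)

lemma ideal_inv_galois: "A \<subseteq> ideal_inv B \<Longrightarrow> B \<subseteq> ideal_inv A"
  by (simp add: ideal_inv_def subset_iff) (metis mult.commute)

lemma ideal_inv_antimono: "A \<subseteq> B \<Longrightarrow> ideal_inv B \<subseteq> ideal_inv A"
  by (auto simp: ideal_inv_def)

lemma v_closure_mono: "A \<subseteq> B \<Longrightarrow> v_closure A \<subseteq> v_closure B"
  unfolding v_closure_def by (intro ideal_inv_antimono)

lemma subset_v_closure: "A \<subseteq> v_closure A"
  by (auto simp: v_closure_def ideal_inv_def mult.commute)

lemma v_closure_idem: "v_closure (v_closure A) = v_closure A"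
proof
  have "ideal_inv A \<subseteq> ideal_inv (v_closure A)"
    using subset_v_closure[of "ideal_inv A"] by (simp add: v_closure_def)
  then show "v_closure (v_closure A) \<subseteq> v_closure A"
    using ideal_inv_antimono unfolding v_closure_def by blast
qed (rule subset_v_closure)

lemma ideal_inv_span: "ideal_inv (fract_mod.span F) = ideal_inv F"
proof
  show "ideal_inv (fract_mod.span F) \<subseteq> ideal_inv F"
    by (intro ideal_inv_antimono fract_mod.span_superset)
  have "fract_mod.span F \<subseteq> ideal_inv (ideal_inv F)"
    using subset_v_closure subspace_ideal_inv unfolding v_closure_def
    by (intro fract_mod.span_minimal)
  then show "ideal_inv F \<subseteq> ideal_inv (fract_mod.span F)"
    by (rule ideal_inv_galois)
qed

lemma v_closure_span: "v_closure (fract_mod.span F) = v_closure F"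
  by (simp add: v_closure_def ideal_inv_span)

lemma v_closure_integral:
  assumes "F \<subseteq> base_dom"
  shows "v_closure F \<subseteq> base_dom"
proof
  fix x assume "x \<in> v_closure F"
  moreover have "1 \<in> ideal_inv F" using assms by (auto simp: ideal_inv_def)
  ultimately have "x * 1 \<in> base_dom" unfolding v_closure_def ideal_inv_def by blast
  then show "x \<in> base_dom" by simp
qed

lemma v_closure_mult:
  assumes s: "s \<in> v_closure F" and t: "t \<in> v_closure G"
  shows "s * t \<in> v_closure ((\<lambda>(f, g). f * g) ` (F \<times> G))"
  unfolding v_closure_def
proof (subst ideal_inv_def, intro CollectI ballI)
  fix u assume u: "u \<in> ideal_inv ((\<lambda>(f, g). f * g) ` (F \<times> G))"
  have "u * g \<in> ideal_inv F" if "g \<in> G" for g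
    using u that by (fastforce simp: ideal_inv_def mult_ac)
  then have "s * (u * g) \<in> base_dom" if "g \<in> G" for g
    using s that by (auto simp: v_closure_def ideal_inv_def)
  then have "s * u \<in> ideal_inv G"
    by (auto simp: ideal_inv_def mult_ac)
  then have "t * (s * u) \<in> base_dom"
    using t by (auto simp: v_closure_def ideal_inv_def)
  then show "s * t * u \<in> base_dom" by (simp add: mult_ac)
qed

lemma v_closure_singleton:
  fixes x :: "'a::idom fract"
  assumes "x \<noteq> 0"
  shows "v_closure {x} = (\<lambda>d. x * d) ` base_dom"
proof
  show "v_closure {x} \<subseteq> (\<lambda>d. x * d) ` base_dom"
  proof
    fix z assume z: "z \<in> v_closure {x}"
    have "inverse x \<in> ideal_inv {x}"
      using assms by (simp add: ideal_inv_def)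
    then have "z * inverse x \<in> base_dom"
      using z unfolding v_closure_def ideal_inv_def[of "ideal_inv {x}"] by blast
    moreover have "z = x * (z * inverse x)" using assms by simp
    ultimately show "z \<in> (\<lambda>d. x * d) ` base_dom" by (rule rev_image_eqI)
  qed
  show "(\<lambda>d. x * d) ` base_dom \<subseteq> v_closure {x}"
    using subspace_mult[OF subspace_v_closure] subset_v_closure[of "{x}"]
    by (auto simp: mult.commute)
qed

section \<open>Integral t-ideals\<close>

text \<open>
  Since \<open>(span F)\<^sub>v = F\<^sub>v\<close>, the \<open>t\<close>-closure can be computed with finite sets in place of finitely
  generated ideals. The sets \<open>F \<subseteq> {0}\<close> have to be excluded because \<open>{0}\<^sub>v\<close> is all of \<open>K\<close>
  when \<open>D = K\<close>.
\<close>

lemma t_ideal_integral_iff: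
  fixes A :: "'a::idom fract set"
  assumes "A \<subseteq> base_dom"
  shows "t_ideal A \<longleftrightarrow> fract_mod.subspace A \<and> A \<noteq> {0} \<and>
    (\<forall>F. finite F \<and> F \<subseteq> A \<and> \<not> F \<subseteq> {0} \<longrightarrow> v_closure F \<subseteq> A)"
proof -
  have frac: "nz_fractional_ideal B \<longleftrightarrow> fract_mod.subspace B \<and> B \<noteq> {0}"
    if "B \<subseteq> base_dom" for B :: "'a fract set"
    using that unfolding nz_fractional_ideal_def by (auto intro!: exI[of _ 1])
  have fg: "nz_fg_fractional_ideal (fract_mod.span F) \<and> fract_mod.span F \<subseteq> A"
    if "fract_mod.subspace A" "finite F" "F \<subseteq> A" "\<not> F \<subseteq> {0}" for F
  proof -
    have "fract_mod.span F \<subseteq> A" using that by (simp add: fract_mod.span_minimal)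
    moreover have "fract_mod.span F \<noteq> {0}" using that(4) fract_mod.span_superset by blast
    ultimately show ?thesis
      using that(2) assms frac[of "fract_mod.span F"] fract_mod.subspace_span
      unfolding nz_fg_fractional_ideal_def by blast
  qed
  show ?thesis
  proof
    assume t: "t_ideal A"
    then have sub: "fract_mod.subspace A" and "A \<noteq> {0}"
      using frac[OF assms] by (auto simp: t_ideal_def)
    moreover have "v_closure F \<subseteq> A" if "finite F" "F \<subseteq> A" "\<not> F \<subseteq> {0}" for F
      using t fg[OF sub that] v_closure_span[of F] unfolding t_ideal_def t_closure_def by blast
    ultimately show "fract_mod.subspace A \<and> A \<noteq> {0} \<and>
      (\<forall>F. finite F \<and> F \<subseteq> A \<and> \<not> F \<subseteq> {0} \<longrightarrow> v_closure F \<subseteq> A)" by blast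
  next
    assume r: "fract_mod.subspace A \<and> A \<noteq> {0} \<and>
      (\<forall>F. finite F \<and> F \<subseteq> A \<and> \<not> F \<subseteq> {0} \<longrightarrow> v_closure F \<subseteq> A)"
    have "t_closure A \<subseteq> A"
    proof
      fix z assume "z \<in> t_closure A"
      then obtain I where I: "nz_fg_fractional_ideal I" "I \<subseteq> A" "z \<in> v_closure I"
        unfolding t_closure_def by blast
      then obtain F where F: "finite F" "I = fract_mod.span F"
        unfolding nz_fg_fractional_ideal_def by blast
      have "\<not> F \<subseteq> {0}"
      proof
        assume "F \<subseteq> {0}"
        then have "I \<subseteq> {0}"
          unfolding F(2) by (intro fract_mod.span_minimal) (auto simp: fract_mod.subspace_def)
        then show False
          using I(1) fract_mod.subspace_0
          unfolding nz_fg_fractional_ideal_def nz_fractional_ideal_def by blast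
      qed
      moreover have "F \<subseteq> A" using I(2) F(2) fract_mod.span_superset by blast
      ultimately show "z \<in> A"
        using r F I(3) v_closure_span[of F] by blast
    qed
    moreover have "A \<subseteq> t_closure A"
    proof
      fix z assume z: "z \<in> A"
      have "0 \<in> A" "A \<noteq> {0}" using r fract_mod.subspace_0 by auto
      then obtain b where b: "b \<in> A" "b \<noteq> 0" by blast
      have "nz_fg_fractional_ideal (fract_mod.span {z, b}) \<and> fract_mod.span {z, b} \<subseteq> A"
        using r z b by (intro fg) simp_all
      moreover have "z \<in> v_closure (fract_mod.span {z, b})"
        using subset_v_closure[of "{z, b}"] v_closure_span[of "{z, b}"] by blast
      ultimately show "z \<in> t_closure A" unfolding t_closure_def by blast
    qed
    ultimately show "t_ideal A"
      using r frac[OF assms] unfolding t_ideal_def by simp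
  qed
qed

lemma t_ideal_integralI:
  assumes "A \<subseteq> base_dom" "fract_mod.subspace A" "A \<noteq> {0}"
    "\<And>F. finite F \<Longrightarrow> F \<subseteq> A \<Longrightarrow> \<not> F \<subseteq> {0} \<Longrightarrow> v_closure F \<subseteq> A"
  shows "t_ideal A"
  using assms by (simp add: t_ideal_integral_iff)

lemma t_ideal_v_closure_subset:
  assumes "t_ideal A" "A \<subseteq> base_dom" "finite F" "F \<subseteq> A" "\<not> F \<subseteq> {0}"
  shows "v_closure F \<subseteq> A"
  using assms by (simp add: t_ideal_integral_iff)

lemma t_ideal_subspace: "t_ideal A \<Longrightarrow> fract_mod.subspace A"
  by (simp add: t_ideal_def nz_fractional_ideal_def)

text \<open>
  The \<open>t\<close>-ideal generated by an arbitrary subset of \<open>D\<close>. Allowing sets that are not submodules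
  makes the ideal \<open>(I + bD)\<^sub>t\<close> available as the closure of \<open>insert b I\<close>.
\<close>

definition t_span :: "'a::idom fract set \<Rightarrow> 'a fract set" where
  "t_span T = (\<Union>F\<in>{F. finite F \<and> F \<subseteq> T \<and> \<not> F \<subseteq> {0}}. v_closure F)"

lemma subset_t_span:
  assumes "\<not> T \<subseteq> {0}"
  shows "T \<subseteq> t_span T"
proof
  fix z assume z: "z \<in> T"
  obtain b where "b \<in> T" "b \<noteq> 0" using assms by blast
  then have "{z, b} \<in> {F. finite F \<and> F \<subseteq> T \<and> \<not> F \<subseteq> {0}}" using z by simp
  moreover have "z \<in> v_closure {z, b}" using subset_v_closure[of "{z, b}"] by blast
  ultimately show "z \<in> t_span T" unfolding t_span_def by blast
qed

lemma t_span_integral: "T \<subseteq> base_dom \<Longrightarrow> t_span T \<subseteq> base_dom"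
  unfolding t_span_def using v_closure_integral by blast

text \<open>
  The sets \<open>F\<^sub>v\<close> whose union is \<open>t_span T\<close> form a directed family. So the union is a submodule,
  and a finite part of the union lies in a single divisorial ideal \<open>F\<^sub>v\<close>, which already contains
  its own \<open>v\<close>-closure.
\<close>

lemma t_ideal_t_span:
  fixes T :: "'a::idom fract set"
  assumes "T \<subseteq> base_dom" "\<not> T \<subseteq> {0}"
  shows "t_ideal (t_span T)"
proof -
  define \<F> where "\<F> = {F. finite F \<and> F \<subseteq> T \<and> \<not> F \<subseteq> {0}}"
  have t_span: "t_span T = \<Union> (v_closure ` \<F>)" by (simp add: t_span_def \<F>_def)
  obtain b where b: "b \<in> T" "b \<noteq> 0" using assms by blast
  have directed: "\<exists>F\<in>\<F>. G \<subseteq> v_closure F" if "finite G" "G \<subseteq> t_span T" for G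
    using that
  proof (induction G rule: finite_induct)
    case empty
    have "{b} \<in> \<F>" using b by (simp add: \<F>_def)
    then show ?case by blast
  next
    case (insert g G)
    then obtain F F' where F: "F \<in> \<F>" "G \<subseteq> v_closure F" and F': "F' \<in> \<F>" "g \<in> v_closure F'"
      unfolding t_span by auto
    have "F \<union> F' \<in> \<F>" using F F' by (auto simp: \<F>_def)
    moreover have "insert g G \<subseteq> v_closure (F \<union> F')"
      using F F' v_closure_mono[of F "F \<union> F'"] v_closure_mono[of F' "F \<union> F'"] by blast
    ultimately show ?case by blast
  qed
  have "fract_mod.subspace (t_span T)"
    unfolding fract_mod.subspace_def
  proof (intro conjI ballI allI)
    show "0 \<in> t_span T"
      using directed[of "{}"] fract_mod.subspace_0[OF subspace_v_closure] unfolding t_span by auto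
    fix x y assume "x \<in> t_span T" "y \<in> t_span T"
    then obtain F where "F \<in> \<F>" "x \<in> v_closure F" "y \<in> v_closure F"
      using directed[of "{x, y}"] by auto
    then show "x + y \<in> t_span T"
      using fract_mod.subspace_add[OF subspace_v_closure] unfolding t_span by blast
  next
    fix c x assume "x \<in> t_span T"
    then show "to_fract c * x \<in> t_span T"
      using fract_mod.subspace_scale[OF subspace_v_closure] unfolding t_span by blast
  qed
  moreover have "t_span T \<noteq> {0}"
    using subset_t_span[OF assms(2)] b by blast
  moreover have "v_closure G \<subseteq> t_span T" if "finite G" "G \<subseteq> t_span T" for G
  proof -
    obtain F where F: "F \<in> \<F>" "G \<subseteq> v_closure F"
      using directed[OF \<open>finite G\<close> \<open>G \<subseteq> t_span T\<close>] by blast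
    have "v_closure G \<subseteq> v_closure F"
      using v_closure_mono[OF F(2)] by (simp only: v_closure_idem)
    then show ?thesis using F(1) unfolding t_span by blast
  qed
  ultimately show ?thesis
    by (intro t_ideal_integralI t_span_integral[OF assms(1)])
qed

lemma t_ideal_principal:
  fixes x :: "'a::idom fract"
  assumes "x \<in> base_dom" "x \<noteq> 0"
  shows "t_ideal ((\<lambda>d. x * d) ` base_dom)" "(\<lambda>d. x * d) ` base_dom \<subseteq> base_dom"
proof -
  have "{F. finite F \<and> F \<subseteq> {x} \<and> \<not> F \<subseteq> {0}} = {{x}}"
    using assms(2) by (auto simp: subset_singleton_iff)
  then have "t_span {x} = (\<lambda>d. x * d) ` base_dom"
    by (simp add: t_span_def v_closure_singleton[OF assms(2)])
  then show "t_ideal ((\<lambda>d. x * d) ` base_dom)" "(\<lambda>d. x * d) ` base_dom \<subseteq> base_dom"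
    using t_ideal_t_span[of "{x}"] t_span_integral[of "{x}"] assms by auto
qed

text \<open>
  Membership in a \<open>t\<close>-ideal is tested on finite sets, and a finite subset of the union of a chain
  lies in one member. This is what makes Zorn's lemma applicable.
\<close>

lemma t_ideal_Union_chain:
  fixes \<C> :: "'a::idom fract set set"
  assumes "\<C> \<noteq> {}" "subset.chain UNIV \<C>"
    and mem: "\<And>N. N \<in> \<C> \<Longrightarrow> t_ideal N \<and> N \<subseteq> base_dom"
  shows "t_ideal (\<Union>\<C>)"
proof -
  have fin: "\<exists>N\<in>\<C>. F \<subseteq> N" if "finite F" "F \<subseteq> \<Union>\<C>" for F
    using finite_subset_Union_chain[OF that assms(1,2)] by blast
  have "fract_mod.subspace (\<Union>\<C>)"
    unfolding fract_mod.subspace_def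
  proof (intro conjI ballI allI)
    show "0 \<in> \<Union>\<C>"
      using assms(1) mem t_ideal_subspace fract_mod.subspace_0 by blast
    fix x y assume "x \<in> \<Union>\<C>" "y \<in> \<Union>\<C>"
    then obtain N where "N \<in> \<C>" "x \<in> N" "y \<in> N" using fin[of "{x, y}"] by auto
    then show "x + y \<in> \<Union>\<C>"
      using mem t_ideal_subspace fract_mod.subspace_add by blast
  next
    fix c x assume "x \<in> \<Union>\<C>"
    then show "to_fract c * x \<in> \<Union>\<C>"
      using mem t_ideal_subspace fract_mod.subspace_scale by blast
  qed
  moreover have "\<Union>\<C> \<noteq> {0}"
  proof
    assume eq: "\<Union>\<C> = {0}"
    obtain N where N: "N \<in> \<C>" using assms(1) by blast
    then have "N \<subseteq> {0}" using eq by blast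
    then show False
      using mem[OF N] fract_mod.subspace_0[of N]
      unfolding t_ideal_def nz_fractional_ideal_def by blast
  qed
  moreover have "v_closure F \<subseteq> \<Union>\<C>" if F: "finite F" "F \<subseteq> \<Union>\<C>" "\<not> F \<subseteq> {0}" for F
  proof -
    obtain N where N: "N \<in> \<C>" "F \<subseteq> N" using fin[OF F(1,2)] by blast
    then have "v_closure F \<subseteq> N" using mem[OF N(1)] F t_ideal_v_closure_subset by blast
    then show ?thesis using N(1) by blast
  qed
  moreover have "\<Union>\<C> \<subseteq> base_dom" using mem by (simp add: Sup_le_iff)
  ultimately show ?thesis by (intro t_ideal_integralI)
qed

section \<open>Prime t-ideals avoiding a multiplicative set\<close>

text \<open>
  The \<open>t\<close>-version of the fact that \<open>(I + bD)(I + cD) \<subseteq> I\<close> whenever \<open>bc \<in> I\<close>. It passes to the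
  closures because \<open>F\<^sub>v G\<^sub>v \<subseteq> (FG)\<^sub>v\<close>.
\<close>

lemma t_span_insert_mult:
  fixes I :: "'a::idom fract set"
  assumes I: "t_ideal I" "I \<subseteq> base_dom" and bc: "b \<in> base_dom" "c \<in> base_dom" "b * c \<in> I"
    and s: "s \<in> t_span (insert b I)" and t: "t \<in> t_span (insert c I)"
  shows "s * t \<in> I"
proof -
  obtain F where F: "finite F" "F \<subseteq> insert b I" "\<not> F \<subseteq> {0}" "s \<in> v_closure F"
    using s unfolding t_span_def by auto
  obtain G where G: "finite G" "G \<subseteq> insert c I" "\<not> G \<subseteq> {0}" "t \<in> v_closure G"
    using t unfolding t_span_def by auto
  let ?H = "(\<lambda>(f, g). f * g) ` (F \<times> G)"
  have "f * g \<in> I" if "f \<in> F" "g \<in> G" for f g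
  proof (cases "f \<in> I")
    case True
    have "g \<in> base_dom" using that(2) G(2) bc(2) I(2) by blast
    then show ?thesis
      using subspace_mult[OF t_ideal_subspace[OF I(1)] _ True, of g] by (simp add: mult.commute)
  next
    case False
    then have "f = b" using that(1) F(2) by blast
    then show ?thesis
      using that(2) G(2) bc subspace_mult[OF t_ideal_subspace[OF I(1)]] by blast
  qed
  then have "?H \<subseteq> I" by auto
  moreover have "\<not> ?H \<subseteq> {0}"
  proof -
    obtain f g where "f \<in> F" "f \<noteq> 0" "g \<in> G" "g \<noteq> 0" using F(3) G(3) by blast
    then have "f * g \<in> ?H" "f * g \<noteq> 0" by auto
    then show ?thesis by blast
  qed
  moreover have "finite ?H" using F(1) G(1) by simp
  ultimately have "v_closure ?H \<subseteq> I"
    using t_ideal_v_closure_subset[OF I] by blast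
  then show ?thesis using v_closure_mult[OF F(4) G(4)] by blast
qed

text \<open>
  As for ordinary ideals, maximality forces primality: if \<open>b, c \<notin> Q\<close>, then the \<open>t\<close>-ideals
  generated by \<open>Q\<close> with \<open>b\<close> and with \<open>c\<close> meet \<open>S\<close>, so their product does, and it would lie in
  \<open>Q\<close> if \<open>bc\<close> did. Maximality is part of the conclusion because \<open>S = {1}\<close> then yields the maximal
  \<open>t\<close>-ideals.
\<close>

lemma prime_t_ideal_avoiding:
  fixes I S :: "'a::idom fract set"
  assumes I: "t_ideal I" "I \<subseteq> base_dom" "I \<inter> S = {}"
    and one: "1 \<in> S" and mult: "\<And>s t. s \<in> S \<Longrightarrow> t \<in> S \<Longrightarrow> s * t \<in> S"
  obtains Q where "prime_t_ideal Q" "I \<subseteq> Q" "Q \<inter> S = {}"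
    "\<And>N. t_ideal N \<Longrightarrow> N \<subseteq> base_dom \<Longrightarrow> Q \<subseteq> N \<Longrightarrow> N \<inter> S = {} \<Longrightarrow> N = Q"
proof -
  let ?\<A> = "{N. t_ideal N \<and> N \<subseteq> base_dom \<and> I \<subseteq> N \<and> N \<inter> S = {}}"
  have "\<exists>Q\<in>?\<A>. \<forall>N\<in>?\<A>. Q \<subseteq> N \<longrightarrow> N = Q"
  proof (rule subset_Zorn_nonempty)
    show "?\<A> \<noteq> {}" using I by blast
    fix \<C> assume C: "\<C> \<noteq> {}" "subset.chain ?\<A> \<C>"
    have "subset.chain UNIV \<C>" using C(2) by (simp add: subset_chain_def)
    moreover have mem: "N \<in> ?\<A>" if "N \<in> \<C>" for N
      using C(2) that by (auto simp: subset_chain_def)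
    ultimately have "t_ideal (\<Union>\<C>)"
      using t_ideal_Union_chain[OF C(1)] by blast
    moreover have "\<Union>\<C> \<subseteq> base_dom" "I \<subseteq> \<Union>\<C>" "\<Union>\<C> \<inter> S = {}"
      using mem C(1) by blast+
    ultimately show "\<Union>\<C> \<in> ?\<A>" by blast
  qed
  then obtain Q where "Q \<in> ?\<A>" and maxQ: "\<forall>N\<in>?\<A>. Q \<subseteq> N \<longrightarrow> N = Q" ..
  then have Q: "t_ideal Q" "Q \<subseteq> base_dom" "I \<subseteq> Q" "Q \<inter> S = {}" by simp_all
  have max: "N = Q" if "t_ideal N" "N \<subseteq> base_dom" "Q \<subseteq> N" "N \<inter> S = {}" for N
    using maxQ that Q(3) by simp
  have "0 \<in> Q" "Q \<noteq> {0}"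
    using Q(1) fract_mod.subspace_0[OF t_ideal_subspace[OF Q(1)]]
    by (simp_all add: t_ideal_def nz_fractional_ideal_def)
  then have nz: "\<not> Q \<subseteq> {0}" by blast
  have meets: "\<exists>s. s \<in> t_span (insert b Q) \<and> s \<in> S" if b: "b \<in> base_dom" "b \<notin> Q" for b
  proof -
    have T: "insert b Q \<subseteq> base_dom" "\<not> insert b Q \<subseteq> {0}" using b Q(2) nz by blast+
    have "insert b Q \<subseteq> t_span (insert b Q)" by (rule subset_t_span[OF T(2)])
    then show ?thesis
      using max[OF t_ideal_t_span[OF T] t_span_integral[OF T(1)]] b(2) by blast
  qed
  have "b \<in> Q \<or> c \<in> Q" if bc: "b \<in> base_dom" "c \<in> base_dom" "b * c \<in> Q" for b c
  proof (rule ccontr)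
    assume "\<not> (b \<in> Q \<or> c \<in> Q)"
    then obtain s t where "s \<in> t_span (insert b Q)" "s \<in> S" "t \<in> t_span (insert c Q)" "t \<in> S"
      using meets bc(1,2) by blast
    then show False
      using t_span_insert_mult[OF Q(1,2) bc] mult Q(4) by blast
  qed
  moreover have "Q \<subset> base_dom"
    using integral_ideal_proper_iff[OF t_ideal_subspace[OF Q(1)] Q(2)] one Q(4) by blast
  ultimately have "prime_t_ideal Q"
    using Q(1) t_ideal_subspace[OF Q(1)] unfolding prime_t_ideal_def prime_ideal_def by blast
  then show ?thesis by (rule that[OF _ Q(3,4) max])
qed

lemma maximal_t_ideal_prime:
  assumes "maximal_t_ideal M"
  shows "prime_t_ideal M"
proof -
  have M: "t_ideal M" "M \<subset> base_dom" "1 \<notin> M"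
    using assms integral_ideal_proper_iff[of M] t_ideal_subspace[of M]
    unfolding maximal_t_ideal_def by blast+
  obtain Q where "prime_t_ideal Q" "M \<subseteq> Q"
    by (rule prime_t_ideal_avoiding[of M "{1}"]) (use M in auto)
  moreover have "Q = M"
    using calculation assms
    unfolding maximal_t_ideal_def prime_t_ideal_def prime_ideal_def by blast
  ultimately show ?thesis by simp
qed

lemma maximal_t_ideal_eqI:
  assumes "maximal_t_ideal M" "maximal_t_ideal N" "M \<subseteq> N"
  shows "M = N"
  using assms by (simp add: maximal_t_ideal_def)

lemma exists_maximal_t_ideal:
  fixes I :: "'a::idom fract set"
  assumes "t_ideal I" "I \<subset> base_dom"
  obtains M where "maximal_t_ideal M" "I \<subseteq> M"
proof -
  have "1 \<notin> I"
    using assms integral_ideal_proper_iff[of I] t_ideal_subspace by blast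
  show ?thesis
  proof (rule prime_t_ideal_avoiding[of I "{1}"])
    show "t_ideal I" "I \<subseteq> base_dom" "I \<inter> {1} = {}" using assms \<open>1 \<notin> I\<close> by auto
    show "(1::'a fract) \<in> {1}" by simp
    show "s * t \<in> {1}" if "s \<in> {1}" "t \<in> {1}" for s t :: "'a fract" using that by simp
    fix Q assume Q: "prime_t_ideal Q" "I \<subseteq> Q"
      and max: "\<And>N. t_ideal N \<Longrightarrow> N \<subseteq> base_dom \<Longrightarrow> Q \<subseteq> N \<Longrightarrow> N \<inter> {1} = {} \<Longrightarrow> N = Q"
    have "maximal_t_ideal Q"
      unfolding maximal_t_ideal_def
    proof (intro conjI allI impI)
      show "t_ideal Q" "Q \<subset> base_dom"
        using Q(1) by (auto simp: prime_t_ideal_def prime_ideal_def)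
      fix N assume N: "t_ideal N \<and> N \<subset> base_dom \<and> Q \<subseteq> N"
      then have "1 \<notin> N" using integral_ideal_proper_iff[of N] t_ideal_subspace by blast
      then show "N = Q" using max[of N] N by auto
    qed
    then show ?thesis using Q(2) by (rule that)
  qed
qed

lemma prime_t_idealD:
  assumes "prime_t_ideal P"
  shows "fract_mod.subspace P" "P \<subseteq> base_dom" "1 \<notin> P"
    "\<And>x y. x \<in> base_dom \<Longrightarrow> y \<in> base_dom \<Longrightarrow> x \<notin> P \<Longrightarrow> y \<notin> P \<Longrightarrow> x * y \<notin> P"
  using assms integral_ideal_proper_iff[of P]
  unfolding prime_t_ideal_def prime_ideal_def by blast+

text \<open>
  In a \<open>t\<close>-treed domain, a prime \<open>t\<close>-ideal inside \<open>M\<close> that contains an element outside \<open>P\<close>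
  must contain \<open>P\<close>. So every element of \<open>P\<close> is in the radical of \<open>xD\<^sub>M\<close>; written without
  localizing, \<open>x\<close> divides some \<open>p\<^sup>nt\<close> with \<open>t \<in> D - M\<close>.
\<close>

lemma divides_power_locally:
  fixes p x :: "'a::idom fract"
  assumes treed: "t_treed TYPE('a)"
    and M: "prime_t_ideal M" and P: "prime_t_ideal P" "P \<subseteq> M"
    and p: "p \<in> P" and x: "x \<in> M" "x \<notin> P"
  obtains n t d where "t \<in> base_dom" "t \<notin> M" "d \<in> base_dom" "p ^ n * t = x * d"
proof -
  define S where "S = {p ^ n * t | n t. t \<in> base_dom \<and> t \<notin> M}"
  let ?I = "(\<lambda>d. x * d) ` base_dom"
  note MD = prime_t_idealD[OF M] and PD = prime_t_idealD[OF P(1)]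
  have xD: "x \<in> base_dom" "x \<noteq> 0"
    using x MD(2) fract_mod.subspace_0[OF PD(1)] by blast+
  have S_I: "p ^ n * t \<in> S" if "t \<in> base_dom" "t \<notin> M" for n t
    using that unfolding S_def by blast
  have "?I \<inter> S \<noteq> {}"
  proof
    assume "?I \<inter> S = {}"
    moreover have "1 \<in> S" using S_I[of 1 0] MD(3) by simp
    moreover have "s * t \<in> S" if st: "s \<in> S" "t \<in> S" for s t
    proof -
      obtain m n u v where "s = p ^ m * u" "t = p ^ n * v" "u \<in> base_dom" "u \<notin> M"
        "v \<in> base_dom" "v \<notin> M" using st unfolding S_def by blast
      moreover have "p ^ (m + n) * (u * v) \<in> S"
        using calculation by (intro S_I base_dom_mult MD(4))
      ultimately show ?thesis by (simp add: power_add mult_ac)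
    qed
    ultimately obtain Q where Q: "prime_t_ideal Q" "?I \<subseteq> Q" "Q \<inter> S = {}"
      by (rule prime_t_ideal_avoiding[OF t_ideal_principal[OF xD], of S]) (assumption | rule that)+
    have "p \<in> S" using S_I[of 1 1] MD(3) by simp
    then have "p \<notin> Q" using Q(3) by blast
    have "Q \<subseteq> M"
    proof
      fix q assume q: "q \<in> Q"
      then have "q \<in> base_dom" using prime_t_idealD(2)[OF Q(1)] by blast
      then show "q \<in> M" using q Q(3) S_I[of q 0] by auto
    qed
    then have "Q \<subseteq> P"
      using treed M P Q(1) p \<open>p \<notin> Q\<close> unfolding t_treed_def by blast
    moreover have "x \<in> Q" using Q(2) base_dom_1 by force
    ultimately show False using x(2) by blast
  qed
  then obtain z where z: "z \<in> ?I" "z \<in> S" by blast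
  then obtain d where d: "d \<in> base_dom" "z = x * d" by blast
  obtain n t where t: "t \<in> base_dom" "t \<notin> M" "z = p ^ n * t"
    using z(2) unfolding S_def by blast
  show ?thesis using that[OF t(1,2) d(1)] t(3) d(2) by metis
qed

section \<open>Valuation elements\<close>

text \<open>
  Contraction is stable under powers: if \<open>a\<^sup>n\<^sup>+\<^sup>1\<close> divides \<open>z\<close> in \<open>V\<close>, then by induction \<open>z = a\<^sup>nw\<close> with
  \<open>w \<in> D\<close>, and \<open>a\<close> divides \<open>w\<close> in \<open>V\<close>.
\<close>

lemma valuation_element_power:
  assumes V: "overring V" and a: "a \<in> base_dom" "a \<noteq> 0"
    and contr: "\<And>z. z \<in> base_dom \<Longrightarrow> z / a \<in> V \<Longrightarrow> z / a \<in> base_dom"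
    and z: "z \<in> base_dom" "z / a ^ n \<in> V"
  shows "z / a ^ n \<in> base_dom"
  using z(2)
proof (induction n)
  case 0
  then show ?case using z(1) by simp
next
  case (Suc n)
  have "a * (z / a ^ Suc n) \<in> V"
    using Suc.prems V a(1) unfolding overring_def by blast
  then have "z / a ^ n \<in> base_dom" using Suc.IH a(2) by simp
  moreover have eq: "z / a ^ Suc n = (z / a ^ n) / a" by (simp add: mult.commute)
  ultimately show ?case using contr[of "z / a ^ n"] Suc.prems unfolding eq by blast
qed

text \<open>
  One of \<open>s\<close> and \<open>t\<close> divides the other in \<open>V\<close>. So if \<open>a\<close> divides \<open>st\<close>, then in \<open>V\<close> it divides
  the square of the multiple among the two, and contraction to \<open>D\<close> gives the same in \<open>D\<close>.
\<close>

lemma valuation_element_dvd_mult: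
  fixes a s t :: "'a::idom fract"
  assumes V: "valuation_overring V"
    and contr: "\<And>z. z \<in> base_dom \<Longrightarrow> z / a \<in> V \<Longrightarrow> z / a \<in> base_dom"
    and st: "s \<in> base_dom" "t \<in> base_dom" "s * t / a \<in> base_dom"
  shows "s * s / a \<in> base_dom \<or> t * t / a \<in> base_dom"
proof -
  have DV: "base_dom \<subseteq> V" and mult: "\<And>x y. x \<in> V \<Longrightarrow> y \<in> V \<Longrightarrow> x * y \<in> V"
    using V unfolding valuation_overring_def overring_def by blast+
  have aux: "t * t / a \<in> base_dom"
    if "s \<noteq> 0" "t / s \<in> V" "t \<in> base_dom" "s * t / a \<in> base_dom" for s t
  proof -
    have "(t / s) * (s * t / a) \<in> V" using that DV mult by blast
    also have "(t / s) * (s * t / a) = t * t / a" using that(1) by simp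
    finally show ?thesis by (rule contr[OF base_dom_mult[OF that(3,3)]])
  qed
  show ?thesis
  proof (cases "s = 0 \<or> t = 0")
    case True
    then show ?thesis by auto
  next
    case False
    then have "t / s \<in> V \<or> inverse (t / s) \<in> V"
      using V unfolding valuation_overring_def by (metis divide_eq_0_iff)
    then show ?thesis
      using False aux[of s t] aux[of t s] st by (auto simp: mult.commute)
  qed
qed

theorem lemma3p2:
  fixes a :: "'a::idom"
  assumes "t_treed TYPE('a)"
    and "valuation_element a"
  shows "homogeneous a"
proof -
  define \<alpha> where "\<alpha> = to_fract a"
  let ?I = "(\<lambda>d. \<alpha> * d) ` base_dom"
  obtain V where a: "a \<noteq> 0" "\<not> a dvd 1" and V: "valuation_overring V"
    and VD: "(\<lambda>v. \<alpha> * v) ` V \<inter> base_dom = ?I"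
    using assms(2) unfolding valuation_element_def \<alpha>_def by blast
  have \<alpha>: "\<alpha> \<in> base_dom" "\<alpha> \<noteq> 0" using a(1) by (auto simp: \<alpha>_def)
  have contr: "z / \<alpha> \<in> base_dom" if "z \<in> base_dom" "z / \<alpha> \<in> V" for z
  proof -
    have "z = \<alpha> * (z / \<alpha>)" using \<alpha>(2) by simp
    then have "z \<in> ?I" using that VD by blast
    then show ?thesis using \<alpha>(2) by auto
  qed
  have over: "overring V" using V by (simp add: valuation_overring_def)
  have I: "t_ideal ?I" "?I \<subseteq> base_dom" using t_ideal_principal[OF \<alpha>] by auto
  have "1 \<notin> ?I"
  proof
    assume "1 \<in> ?I"
    then obtain d where "to_fract 1 = to_fract (a * d)"
      by (auto simp: \<alpha>_def)
    then have "1 = a * d" by (simp only: to_fract_eq_iff)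
    then show False using a(2) by (metis dvd_triv_left)
  qed
  then have "?I \<subset> base_dom"
    using integral_ideal_proper_iff[OF t_ideal_subspace[OF I(1)] I(2)] by simp
  then obtain M\<^sub>0 where M\<^sub>0: "maximal_t_ideal M\<^sub>0" "?I \<subseteq> M\<^sub>0"
    by (rule exists_maximal_t_ideal[OF I(1)])
  have I_iff: "z \<in> ?I \<longleftrightarrow> z / \<alpha> \<in> base_dom" for z
  proof
    show "z \<in> ?I" if "z / \<alpha> \<in> base_dom"
      using \<alpha>(2) by (intro rev_image_eqI[OF that]) simp
  qed (use \<alpha>(2) in auto)
  have "\<alpha> \<in> ?I" using I_iff \<alpha>(2) by simp

  \<comment> \<open>The contradiction, for a pair of elements oriented by divisibility in \<open>V\<close>.\<close>
  have clash: False
    if M: "prime_t_ideal M" and P: "prime_t_ideal P" "P \<subseteq> M" "\<alpha> \<in> P"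
      and x: "x \<in> M" "x \<notin> P" and y: "y \<in> base_dom" "y \<notin> M" and yx: "y / x \<in> V"
    for M P x y
  proof -
    note MD = prime_t_idealD[OF M]
    have "x \<noteq> 0" using x(2) fract_mod.subspace_0[OF prime_t_idealD(1)[OF P(1)]] by blast
    obtain n t d where t: "t \<in> base_dom" "t \<notin> M" and d: "d \<in> base_dom" "\<alpha> ^ n * t = x * d"
      by (rule divides_power_locally[OF assms(1) M P x])
    have eq: "y * d / \<alpha> ^ n = t * (y / x)"
      using d(2) \<alpha>(2) \<open>x \<noteq> 0\<close> by (simp add: field_simps)
    have "t * (y / x) \<in> V" using t(1) yx over unfolding overring_def by blast
    then have "t * (y / x) \<in> base_dom"
      using valuation_element_power[OF over \<alpha> contr base_dom_mult[OF y(1) d(1)], of n]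
      unfolding eq by blast
    then have "t * (y / x) * x \<in> M" using subspace_mult[OF MD(1) _ x(1)] by blast
    then show False using MD(4)[OF t(1) y(1) t(2) y(2)] \<open>x \<noteq> 0\<close> by simp
  qed

  have unique: "M = M'"
    if M: "maximal_t_ideal M" "\<alpha> \<in> M" and M': "maximal_t_ideal M'" "\<alpha> \<in> M'" for M M'
  proof (rule ccontr)
    assume "M \<noteq> M'"
    note pM = maximal_t_ideal_prime[OF M(1)] and pM' = maximal_t_ideal_prime[OF M'(1)]
    note MD = prime_t_idealD[OF pM] and MD' = prime_t_idealD[OF pM']
    have "\<not> M \<subseteq> M'" "\<not> M' \<subseteq> M"
      using \<open>M \<noteq> M'\<close> maximal_t_ideal_eqI[OF M(1) M'(1)] maximal_t_ideal_eqI[OF M'(1) M(1)]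
      by blast+
    then obtain x y where x: "x \<in> M" "x \<notin> M'" and y: "y \<in> M'" "y \<notin> M" by blast
    define S where "S = {s * t | s t. s \<in> base_dom - M \<and> t \<in> base_dom - M'}"
    have S_I: "s * t \<in> S" if "s \<in> base_dom" "s \<notin> M" "t \<in> base_dom" "t \<notin> M'" for s t
      using that unfolding S_def by blast
    have "?I \<inter> S = {}"
    proof (rule ccontr)
      assume "?I \<inter> S \<noteq> {}"
      then obtain z where z: "z \<in> ?I" "z \<in> S" by blast
      then obtain s t where st: "s \<in> base_dom" "s \<notin> M" "t \<in> base_dom" "t \<notin> M'" "z = s * t"
        unfolding S_def by blast
      have "s * t / \<alpha> \<in> base_dom" using z(1) unfolding st(5) I_iff .
      then consider "s * s / \<alpha> \<in> base_dom" | "t * t / \<alpha> \<in> base_dom"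
        using valuation_element_dvd_mult[OF V contr st(1,3)] by blast
      then show False
      proof cases
        case 1
        then have "s * s / \<alpha> * \<alpha> \<in> M" by (rule subspace_mult[OF MD(1) _ M(2)])
        then show False using MD(4)[OF st(1,1) st(2,2)] \<alpha>(2) by simp
      next
        case 2
        then have "t * t / \<alpha> * \<alpha> \<in> M'" by (rule subspace_mult[OF MD'(1) _ M'(2)])
        then show False using MD'(4)[OF st(3,3) st(4,4)] \<alpha>(2) by simp
      qed
    qed
    moreover have "1 \<in> S" using S_I[of 1 1] MD(3) MD'(3) by simp
    moreover have "u * w \<in> S" if uw: "u \<in> S" "w \<in> S" for u w
    proof -
      obtain s t s' t' where "u = s * t" "w = s' * t'"
        and s: "s \<in> base_dom" "s \<notin> M" "s' \<in> base_dom" "s' \<notin> M"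
        and t: "t \<in> base_dom" "t \<notin> M'" "t' \<in> base_dom" "t' \<notin> M'"
        using uw unfolding S_def by blast
      moreover have "(s * s') * (t * t') \<in> S"
        using s t by (intro S_I base_dom_mult MD(4) MD'(4))
      ultimately show ?thesis by (simp add: mult_ac)
    qed
    ultimately obtain P where P: "prime_t_ideal P" "?I \<subseteq> P" "P \<inter> S = {}"
      by (rule prime_t_ideal_avoiding[OF I, of S]) (assumption | rule that)+
    have "z \<in> M \<and> z \<in> M'" if z: "z \<in> P" for z
    proof -
      have "z \<in> base_dom" "z \<notin> S" using z P(3) prime_t_idealD(2)[OF P(1)] by blast+
      then show ?thesis using S_I[of z 1] S_I[of 1 z] MD(3) MD'(3) by auto
    qed
    then have PM: "P \<subseteq> M" and PM': "P \<subseteq> M'" by blast+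
    have \<alpha>P: "\<alpha> \<in> P" using P(2) \<open>\<alpha> \<in> ?I\<close> by blast
    have D: "x \<in> base_dom" "y \<in> base_dom" "x \<notin> P" "y \<notin> P"
      using x y MD(2) MD'(2) PM PM' by blast+
    then have "y / x \<noteq> 0"
      using fract_mod.subspace_0[OF prime_t_idealD(1)[OF P(1)]] by auto
    then have "y / x \<in> V \<or> x / y \<in> V"
      using V unfolding valuation_overring_def by (metis inverse_divide)
    then show False
      using clash[OF pM P(1) PM \<alpha>P x(1) D(3) D(2) y(2)]
        clash[OF pM' P(1) PM' \<alpha>P y(1) D(4) D(1) x(2)] by blast
  qed
  have "\<exists>!M. maximal_t_ideal M \<and> \<alpha> \<in> M"
    using M\<^sub>0 \<open>\<alpha> \<in> ?I\<close> unique by blast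
  then show ?thesis using a unfolding homogeneous_def \<alpha>_def by blast
qed

end
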